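(* Let $f:\operatorname{dom}(f)\subseteq\mathbb{R}^n\to\mathbb{R}$ be $\mathcal{C}^3$ on the open ball $B(x^0,\overline{\Delta})$, and denote by $L$ the Lipschitz constant of $\nabla^2 f$ on this ball. Let $\mathcal{X}=\langle x^0,x^1,\ldots,x^m\rangle$ be an ordered set of distinct points with radius $\Delta<\overline{\Delta}$ such that $S=S(\mathcal{X})$ has full rank. Let $\mathbb{U}=\operatorname{span}S$, $\widehat{S}=S/\Delta$ and $a>0$. Then $$\big\|\nabla^{cc}a^{f(\mathcal{X})}-\nabla a^{f_{\mathbb{U}}(x^0)}\big\|\le\big|a^{f(x^0)}\ln a\big|\,\frac{L\sqrt{m}}{6}\,\big\|(\widehat{S}^\top)^\dagger\big\|\Delta^2.$$
   Context: Vectors carry the Euclidean norm and matrices the induced operator norm; $A^\dagger$ is the Moore--Penrose pseudoinverse. For $\mathcal{X}=\langle x^0,x^1,\ldots,x^m\rangle\subset\mathbb{R}^n$ write $x^i=x^0+d^i$ ($m\ge1$); the radius is $\Delta=\max_i\|d^i\|$ and $S(\mathcal{X})=[d^1\ \cdots\ d^m]\in\mathbb{R}^{n\times m}$. Full rank means $\operatorname{rank}S=\min\{m,n\}$; $\operatorname{span}S$ is the column span. The generalized centred simplex gradient of $f$ over $\mathcal{X}$ is $\nabla^c f(\mathcal{X})=(S^\top)^\dagger\delta^c_f(\mathcal{X})$, where $\delta^c_f(\mathcal{X})\in\mathbb{R}^m$ has $i$-th entry $\tfrac12\big(f(x^0+d^i)-f(x^0-d^i)\big)$. The generalized centred simplex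 calculus gradient of $a^f$ over $\mathcal{X}$ is defined as $\nabla^{cc}a^{f(\mathcal{X})}=a^{f(x^0)}\,(\ln a)\,\nabla^c f(\mathcal{X})$. $f_{\mathbb{U}}(y)=f\big(x^0+\operatorname{Proj}_{\mathbb{U}}(y-x^0)\big)$ with $\operatorname{Proj}_{\mathbb{U}}$ the orthogonal projection onto $\mathbb{U}$, and $\nabla a^{f_{\mathbb{U}}(x^0)}$ denotes the gradient at $y=x^0$ of $y\mapsto a^{f_{\mathbb{U}}(y)}$. The Lipschitz constant is assumed finite: $\|\nabla^2 f(x)-\nabla^2 f(y)\|\le L\|x-y\|$ on $B(x^0,\overline{\Delta})$. *)

theory Defs
  imports "HOL-Analysis.Analysis"
begin

text \<open>The library norm on matrices is the Frobenius norm; the norm used here is the one induced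
  by the Euclidean vector norms.\<close>

definition opnorm :: "real^'n^'m \<Rightarrow> real" where
  "opnorm A = onorm ((*v) A)"

definition is_pinv :: "real^'n^'m \<Rightarrow> real^'m^'n \<Rightarrow> bool" where
  "is_pinv A X \<longleftrightarrow>
     A ** X ** A = A \<and> X ** A ** X = X \<and>
     transpose (A ** X) = A ** X \<and> transpose (X ** A) = X ** A"

text \<open>The four Penrose conditions have exactly one solution for every real matrix.\<close>

definition pinv :: "real^'n^'m \<Rightarrow> real^'m^'n" where
  "pinv A = (THE X. is_pinv A X)"

definition gradient :: "(real^'n \<Rightarrow> real) \<Rightarrow> real^'n \<Rightarrow> real^'n" where
  "gradient f y = (THE D. GDERIV f y :> D)"

definition partial :: "'n \<Rightarrow> (real^'n \<Rightarrow> real) \<Rightarrow> real^'n \<Rightarrow> real" where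
  "partial i f y = frechet_derivative f (at y) (axis i 1)"

definition hessian :: "(real^'n \<Rightarrow> real) \<Rightarrow> real^'n \<Rightarrow> real^'n^'n" where
  "hessian f y = (\<chi> i j. partial i (partial j f) y)"

text \<open>Meant for open \<open>U\<close>, since \<open>partial\<close> uses two-sided derivatives.\<close>

fun Ck_on :: "nat \<Rightarrow> (real^'n \<Rightarrow> real) \<Rightarrow> (real^'n) set \<Rightarrow> bool" where
  "Ck_on 0 f U \<longleftrightarrow> continuous_on U f"
| "Ck_on (Suc k) f U \<longleftrightarrow>
     (\<forall>y\<in>U. f differentiable (at y)) \<and> (\<forall>i. Ck_on k (partial i f) U)"

definition Proj :: "(real^'n) set \<Rightarrow> real^'n \<Rightarrow> real^'n" where
  "Proj U y = (THE p. p \<in> U \<and> y - p \<in> orthogonal_comp U)"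

text \<open>An ordered sample set \<open>\<langle>x\<^sup>0, x\<^sup>1, \<dots>, x\<^sup>m\<rangle>\<close> is given by the point \<open>x0\<close> and the family
  \<open>x\<close> indexed by a finite type \<open>'m\<close> with \<open>m = CARD('m)\<close>, so \<open>d\<^sup>i = x i - x0\<close>.\<close>

definition radius :: "real^'n \<Rightarrow> ('m::finite \<Rightarrow> real^'n) \<Rightarrow> real" where
  "radius x0 x = Max (range (\<lambda>i. norm (x i - x0)))"

definition sample_matrix :: "real^'n \<Rightarrow> ('m::finite \<Rightarrow> real^'n) \<Rightarrow> real^'m^'n" where
  "sample_matrix x0 x = (\<chi> j i. (x i - x0) $ j)"

definition delta_c ::
    "(real^'n \<Rightarrow> real) \<Rightarrow> real^'n \<Rightarrow> ('m::finite \<Rightarrow> real^'n) \<Rightarrow> real^'m" where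
  "delta_c f x0 x = (\<chi> i. (f (x0 + (x i - x0)) - f (x0 - (x i - x0))) / 2)"

definition centred_simplex_gradient ::
    "(real^'n \<Rightarrow> real) \<Rightarrow> real^'n \<Rightarrow> ('m::finite \<Rightarrow> real^'n) \<Rightarrow> real^'n" where
  "centred_simplex_gradient f x0 x = pinv (transpose (sample_matrix x0 x)) *v delta_c f x0 x"

definition centred_calculus_gradient_exp ::
    "real \<Rightarrow> (real^'n \<Rightarrow> real) \<Rightarrow> real^'n \<Rightarrow> ('m::finite \<Rightarrow> real^'n) \<Rightarrow> real^'n" where
  "centred_calculus_gradient_exp a f x0 x =
     (a powr f x0 * ln a) *\<^sub>R centred_simplex_gradient f x0 x"

definition restrict_proj ::
    "(real^'n) set \<Rightarrow> real^'n \<Rightarrow> (real^'n \<Rightarrow> real) \<Rightarrow> real^'n \<Rightarrow> real" where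
  "restrict_proj U x0 f y = f (x0 + Proj U (y - x0))"

end

theory Submission imports Defs begin

text \<open>
  Write \<open>A = S\<^sup>T\<close>, \<open>c = (a powr f x0) ln a\<close> and let \<open>g\<close> be the gradient of \<open>f\<close> at \<open>x0\<close>. The
  estimate rests on expressing both vectors through the pseudoinverse of \<open>A\<close>. The simplex calculus gradient is
  \<open>c A\<^sup>\<dagger> \<delta>\<close> by definition. By the chain rule, and because an orthogonal projection is
  self-adjoint, the true gradient of \<open>a\<close> to the power \<open>f\<^sub>U\<close> is \<open>c Proj\<^sub>U g\<close>
  (\<open>gradient_powr_restrict_proj\<close>). Since \<open>A\<^sup>\<dagger> A\<close> is the orthogonal projection onto the row space of
  \<open>A\<close>, which is \<open>U\<close>, this equals \<open>c A\<^sup>\<dagger> (A g)\<close> (\<open>pinv_mult_is_Proj_rowspace\<close>). Hence the error is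
  \<open>c A\<^sup>\<dagger> (\<delta> - A g)\<close>.

  The entries of \<open>\<delta> - A g\<close> are errors of central differences. The even order Taylor terms cancel
  in \<open>f (x0 + d) - f (x0 - d)\<close>, so that a Lipschitz Hessian gives an error of at most
  \<open>L / 6\<close> times the cube of the step (\<open>central_difference_error\<close>). Bounding each step by
  \<open>\<Delta>\<close> and passing from entries to the Euclidean norm gives the factors \<open>\<Delta>\<^sup>3\<close> and \<open>sqrt m\<close>; one
  power of \<open>\<Delta>\<close> is absorbed by the scaling rule for pseudoinverses when
  \<open>A\<^sup>\<dagger>\<close> is replaced by the pseudoinverse of \<open>A / \<Delta>\<close>.
\<close>

section \<open>Adjoints and orthogonal projections\<close>

lemma inner_matrix_vector_transpose:
  fixes A :: "real^'n^'m"
  shows "x \<bullet> (A *v y) = (transpose A *v x) \<bullet> y"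
  by (metis dot_lmul_matrix vector_transpose_matrix transpose_transpose)

lemma symmetric_matrixI:
  fixes M :: "real^'n^'n"
  assumes "\<And>v w. (M *v v) \<bullet> w = v \<bullet> (M *v w)"
  shows "transpose M = M"
proof -
  have "transpose M *v v = M *v v" for v
    using assms by (metis inner_matrix_vector_transpose vector_eq_ldot inner_commute)
  then show ?thesis by (simp add: matrix_eq)
qed

text \<open>Two candidates for the projection differ by a vector of \<open>U\<close> that is orthogonal to \<open>U\<close>, hence
  to itself; so the definite description in the definition of \<open>Proj\<close> is proper.\<close>

lemma Proj_characterization:
  fixes U :: "(real^'n) set"
  assumes "subspace U"
  shows "Proj U y \<in> U \<and> y - Proj U y \<in> orthogonal_comp U"
proof -
  have "\<exists>!p. p \<in> U \<and> y - p \<in> orthogonal_comp U"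
  proof (rule ex_ex1I)
    obtain p z where "p \<in> span U" "\<And>w. w \<in> span U \<Longrightarrow> orthogonal z w" "y = p + z"
      using orthogonal_subspace_decomp_exists[of U y] by blast
    then show "\<exists>p. p \<in> U \<and> y - p \<in> orthogonal_comp U"
      using span_eq_iff[THEN iffD2, OF assms]
      by (auto simp: orthogonal_comp_def orthogonal_commute intro!: exI[of _ p])
  next
    fix p q
    assume "p \<in> U \<and> y - p \<in> orthogonal_comp U" "q \<in> U \<and> y - q \<in> orthogonal_comp U"
    then have "(p - q) \<bullet> (y - p) = 0" "(p - q) \<bullet> (y - q) = 0"
      using assms by (auto simp: orthogonal_comp_def orthogonal_def subspace_diff)
    then have "(p - q) \<bullet> (p - q) = 0"
      by (simp add: inner_diff_right)
    then show "p = q" by simp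
  qed
  then show ?thesis unfolding Proj_def by (rule theI')
qed

lemma Proj_unique:
  fixes U :: "(real^'n) set"
  assumes "subspace U" "p \<in> U" "\<And>w. w \<in> U \<Longrightarrow> w \<bullet> (y - p) = 0"
  shows "Proj U y = p"
proof -
  let ?q = "Proj U y"
  have q: "?q \<in> U" "\<And>w. w \<in> U \<Longrightarrow> w \<bullet> (y - ?q) = 0"
    using Proj_characterization[OF assms(1), of y]
    by (auto simp: orthogonal_comp_def orthogonal_def)
  have "(?q - p) \<bullet> (y - p) = 0" "(?q - p) \<bullet> (y - ?q) = 0"
    using q assms subspace_diff by blast+
  then have "(?q - p) \<bullet> (?q - p) = 0" by (simp add: inner_diff_right)
  then show ?thesis by simp
qed

lemma Proj_self_adjoint:
  fixes U :: "(real^'n) set"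
  assumes "subspace U"
  shows "Proj U v \<bullet> w = v \<bullet> Proj U w"
proof -
  have "Proj U v \<bullet> (w - Proj U w) = 0" "Proj U w \<bullet> (v - Proj U v) = 0"
    using Proj_characterization[OF assms]
    by (auto simp: orthogonal_comp_def orthogonal_def)
  then show ?thesis by (simp add: inner_diff_right inner_commute)
qed

text \<open>Any map with an adjoint is linear: pair both sides with an arbitrary vector and move
  the map to that vector.\<close>

lemma linear_Proj:
  fixes U :: "(real^'n) set"
  assumes "subspace U"
  shows "linear (Proj U)"
proof (rule linearI)
  fix v w :: "real^'n" and c :: real
  have "Proj U (v + w) \<bullet> z = (Proj U v + Proj U w) \<bullet> z" for z
    by (simp add: Proj_self_adjoint[OF assms] inner_add_left)
  then show "Proj U (v + w) = Proj U v + Proj U w"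
    using vector_eq_rdot by blast
  have "Proj U (c *\<^sub>R v) \<bullet> z = (c *\<^sub>R Proj U v) \<bullet> z" for z
    by (simp add: Proj_self_adjoint[OF assms])
  then show "Proj U (c *\<^sub>R v) = c *\<^sub>R Proj U v"
    using vector_eq_rdot by blast
qed

lemma Proj_id:
  fixes U :: "(real^'n) set"
  assumes "subspace U" "v \<in> U"
  shows "Proj U v = v"
  using assms by (intro Proj_unique) auto

section \<open>The Moore--Penrose pseudoinverse\<close>

text \<open>Transposing \<open>A X = (A Y) (A X)\<close> swaps the two symmetric factors, and \<open>(A X) (A Y) = A Y\<close>. So
  \<open>A X = A Y\<close>, likewise \<open>X A = Y A\<close>, and then \<open>X = X A X = X A Y = Y A Y = Y\<close>.\<close>

lemma is_pinv_unique:
  fixes A :: "real^'n^'m"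
  assumes "is_pinv A X" "is_pinv A Y"
  shows "X = Y"
proof -
  have X: "A ** X ** A = A" "X ** A ** X = X"
      "transpose (A ** X) = A ** X" "transpose (X ** A) = X ** A"
    and Y: "A ** Y ** A = A" "Y ** A ** Y = Y"
      "transpose (A ** Y) = A ** Y" "transpose (Y ** A) = Y ** A"
    using assms by (simp_all add: is_pinv_def)
  have "A ** X = (A ** Y) ** (A ** X)"
    using Y(1) by (simp add: matrix_mul_assoc)
  also have "\<dots> = transpose ((A ** X) ** (A ** Y))"
    by (metis X(3) Y(3) matrix_transpose_mul)
  also have "\<dots> = A ** Y"
    using X(1) Y(3) by (simp add: matrix_mul_assoc)
  finally have AX: "A ** X = A ** Y" .
  have "X ** A = (X ** A) ** (Y ** A)"
    using Y(1) by (metis matrix_mul_assoc)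
  also have "\<dots> = transpose ((Y ** A) ** (X ** A))"
    by (metis X(4) Y(4) matrix_transpose_mul)
  also have "\<dots> = Y ** A"
    using X(1) Y(4) by (metis matrix_mul_assoc)
  finally have XA: "X ** A = Y ** A" .
  show ?thesis by (metis X(2) Y(2) AX XA matrix_mul_assoc)
qed

text \<open>The matrix \<open>A\<close> maps its row space \<open>R\<close> bijectively onto its column space \<open>C\<close>. Projecting onto
  \<open>C\<close> and then inverting this bijection gives \<open>X\<close> with \<open>X A = Proj\<^sub>R\<close> and \<open>A X = Proj\<^sub>C\<close>, from
  which all four Penrose conditions follow at once.\<close>

lemma is_pinv_exists:
  fixes A :: "real^'n^'m"
  shows "\<exists>X. is_pinv A X"
proof -
  define R where "R = range ((*v) (transpose A))"
  define C where "C = range ((*v) A)"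
  have R: "subspace R" and C: "subspace C"
    unfolding R_def C_def
    by (rule linear_subspace_image[OF matrix_vector_mul_linear subspace_UNIV])+
  \<comment> \<open>The kernel of \<open>A\<close> is the orthogonal complement of \<open>R\<close>, so \<open>A\<close> does not see the component
    that the projection removes.\<close>
  have AP: "A *v Proj R v = A *v v" for v
  proof -
    have "transpose A *v w \<in> R" for w by (simp add: R_def)
    then have "(transpose A *v w) \<bullet> (v - Proj R v) = 0" for w
      using Proj_characterization[OF R, of v] by (auto simp: orthogonal_comp_def orthogonal_def)
    then have "w \<bullet> (A *v (v - Proj R v)) = 0" for w
      by (simp add: inner_matrix_vector_transpose)
    from this[of "A *v (v - Proj R v)"] show ?thesis
      by (simp add: matrix_vector_mult_diff_distrib)
  qed
  have "inj_on ((*v) A) R"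
  proof (rule inj_onI)
    fix u v assume uv: "u \<in> R" "v \<in> R" "A *v u = A *v v"
    then have "u - v \<in> R" using R subspace_diff by blast
    then obtain w where w: "u - v = transpose A *v w" unfolding R_def by blast
    have "A *v (u - v) = 0" using uv(3) by (simp add: matrix_vector_mult_diff_distrib)
    then have "(u - v) \<bullet> (u - v) = 0"
      using inner_matrix_vector_transpose[of w A "u - v"] w by simp
    then show "u = v" by simp
  qed
  then obtain g where g: "range g \<subseteq> R" "linear g" "\<And>v. v \<in> R \<Longrightarrow> g (A *v v) = v"
    using real_vector.linear_exists_left_inverse_on[OF matrix_vector_mul_linear R]
    by metis
  define X where "X = matrix (g \<circ> Proj C)"
  have X: "X *v w = g (Proj C w)" for w
    unfolding X_def using matrix_works[of "g \<circ> Proj C"] linear_compose[OF linear_Proj[OF C] g(2)]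
    by simp
  have XA: "X *v (A *v v) = Proj R v" for v
  proof -
    have "A *v v \<in> C" by (simp add: C_def)
    then have "X *v (A *v v) = g (A *v Proj R v)"
      by (simp add: X Proj_id[OF C] AP)
    also have "\<dots> = Proj R v"
      using g(3) Proj_characterization[OF R] by blast
    finally show ?thesis .
  qed
  have AX: "A *v (X *v w) = Proj C w" for w
  proof -
    obtain v where v: "Proj C w = A *v v"
      using Proj_characterization[OF C, of w] unfolding C_def by blast
    then have "X *v w = Proj R v"
      by (metis X XA Proj_id[OF C] rangeI C_def)
    then show ?thesis using v AP by simp
  qed
  have "is_pinv A X" unfolding is_pinv_def
  proof (intro conjI)
    show "A ** X ** A = A"
      by (simp add: matrix_eq matrix_vector_mul_assoc[symmetric] XA AP)
    show "X ** A ** X = X"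
    proof -
      have "Proj R (X *v w) = X *v w" for w
        using g(1) by (intro Proj_id[OF R]) (auto simp: X)
      then show ?thesis
        by (simp add: matrix_eq matrix_vector_mul_assoc[symmetric] XA)
    qed
    show "transpose (A ** X) = A ** X"
      by (rule symmetric_matrixI)
        (simp add: matrix_vector_mul_assoc[symmetric] AX Proj_self_adjoint[OF C])
    show "transpose (X ** A) = X ** A"
      by (rule symmetric_matrixI)
        (simp add: matrix_vector_mul_assoc[symmetric] XA Proj_self_adjoint[OF R])
  qed
  then show ?thesis ..
qed

lemma pinv_eqI: "is_pinv A X \<Longrightarrow> pinv A = X"
  unfolding pinv_def using is_pinv_unique by blast

lemma is_pinv_pinv: "is_pinv A (pinv A)"
  using is_pinv_exists[of A] pinv_eqI by metis

lemma pinv_scaleR: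
  fixes A :: "real^'n^'m"
  assumes "c \<noteq> 0"
  shows "pinv (c *\<^sub>R A) = inverse c *\<^sub>R pinv A"
proof (rule pinv_eqI)
  have "is_pinv A (pinv A)" by (rule is_pinv_pinv)
  then show "is_pinv (c *\<^sub>R A) (inverse c *\<^sub>R pinv A)"
    using assms
    by (simp add: is_pinv_def scalar_matrix_assoc[symmetric] matrix_scalar_ac)
qed

text \<open>Symmetry of \<open>X A\<close> gives \<open>X A = A\<^sup>T X\<^sup>T\<close>, which has its range in the row space of \<open>A\<close>; and
  \<open>A X A = A\<close> says that \<open>v - X A v\<close> lies in the kernel of \<open>A\<close>, that is, is orthogonal to all
  rows.\<close>

lemma pinv_mult_is_Proj_rowspace:
  fixes A :: "real^'n^'m"
  shows "pinv A *v (A *v v) = Proj (span (columns (transpose A))) v"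
proof -
  define X where "X = pinv A"
  have X: "A ** X ** A = A" "transpose (X ** A) = X ** A"
    using is_pinv_pinv[of A] by (simp_all add: is_pinv_def X_def)
  let ?p = "X *v (A *v v)"
  have "Proj (span (columns (transpose A))) v = ?p"
  proof (rule Proj_unique)
    have "?p = transpose (X ** A) *v v"
      by (simp only: X(2) matrix_vector_mul_assoc)
    also have "\<dots> = transpose A *v (transpose X *v v)"
      by (simp only: matrix_transpose_mul matrix_vector_mul_assoc)
    finally show "?p \<in> span (columns (transpose A))"
      by (simp only: matrix_vector_mult_in_columnspace)
    have "A *v (v - ?p) = A *v v - (A ** X ** A) *v v"
      by (simp add: matrix_vector_mult_diff_distrib matrix_vector_mul_assoc matrix_mul_assoc)
    then have 0: "A *v (v - ?p) = 0" by (simp add: X(1))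
    have comp: "row i A \<bullet> (v - ?p) = 0" for i
      using arg_cong[OF 0, of "\<lambda>u. u $ i"] by (simp add: matrix_vector_mul_component row_def)
    fix w assume "w \<in> span (columns (transpose A))"
    then have "orthogonal (v - ?p) w"
      by (rule orthogonal_to_span)
        (auto simp: rows_def orthogonal_def comp inner_commute)
    then show "w \<bullet> (v - ?p) = 0" by (simp add: orthogonal_def inner_commute)
  qed simp
  then show ?thesis by (simp add: X_def)
qed

section \<open>Norms\<close>

lemma opnorm_scaleR: "opnorm (c *\<^sub>R A) = \<bar>c\<bar> * opnorm A"
proof -
  have "onorm (\<lambda>v. c *\<^sub>R (A *v v)) = \<bar>c\<bar> * onorm ((*v) A)"
    by (rule onorm_scaleR) simp
  moreover have "(*v) (c *\<^sub>R A) = (\<lambda>v. c *\<^sub>R (A *v v))"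
    by (simp add: fun_eq_iff scaleR_matrix_vector_assoc)
  ultimately show ?thesis by (simp add: opnorm_def)
qed

lemma norm_matrix_vector_le_opnorm: "norm (A *v v) \<le> opnorm A * norm v"
  unfolding opnorm_def by (rule onorm) simp

lemma opnorm_nonneg: "0 \<le> opnorm A"
  unfolding opnorm_def by (rule onorm_pos_le) simp

lemma norm_le_sqrt_card:
  fixes v :: "real^'m"
  assumes "\<And>i. \<bar>v $ i\<bar> \<le> c"
  shows "norm v \<le> sqrt (real CARD('m)) * c"
proof -
  have "0 \<le> c" using assms[of undefined] by linarith
  have "norm v \<le> L2_set (\<lambda>i::'m. c) UNIV"
    unfolding norm_vec_def using assms by (intro L2_set_mono) auto
  then show ?thesis using \<open>0 \<le> c\<close> by (simp add: L2_set_constant)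
qed

section \<open>Gradients and Hessians\<close>

lemma Ck_on_Suc_imp_Ck_on: "Ck_on (Suc k) f U \<Longrightarrow> Ck_on k f U"
proof (induction k arbitrary: f)
  case 0
  then have "f differentiable_on U"
    by (auto simp: differentiable_on_def intro: differentiable_at_withinI)
  then show ?case by (simp add: differentiable_imp_continuous_on)
next
  case (Suc k)
  then show ?case by (meson Ck_on.simps(2))
qed

lemma GDERIV_partials:
  fixes f :: "real^'n \<Rightarrow> real"
  assumes "f differentiable (at y)"
  shows "GDERIV f y :> (\<chi> i. partial i f y)"
proof -
  let ?D = "frechet_derivative f (at y)"
  have D: "(f has_derivative ?D) (at y)"
    using assms frechet_derivative_works by blast
  then have lin: "linear ?D" by (rule has_derivative_linear)
  have "?D = (\<lambda>h. h \<bullet> (\<chi> i. partial i f y))"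
  proof
    fix h
    have "?D h = ?D (\<Sum>i\<in>UNIV. (h $ i) *\<^sub>R axis i 1)"
      by (simp add: basis_expansion flip: scalar_mult_eq_scaleR)
    also have "\<dots> = (\<Sum>i\<in>UNIV. h $ i * partial i f y)"
      by (simp add: linear_sum[OF lin] linear_scale[OF lin] partial_def)
    finally show "?D h = h \<bullet> (\<chi> i. partial i f y)" by (simp add: inner_vec_def)
  qed
  then show ?thesis using D by (simp add: gderiv_def)
qed

lemma gradient_eqI:
  assumes "GDERIV f y :> D"
  shows "gradient f y = D"
  unfolding gradient_def
proof (rule the_equality[where P="\<lambda>D. GDERIV f y :> D", OF assms])
  fix E assume "GDERIV f y :> E"
  then have "(\<lambda>h. h \<bullet> E) = (\<lambda>h. h \<bullet> D)"
    using assms has_derivative_unique unfolding gderiv_def by blast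
  then show "E = D" by (metis vector_eq_ldot)
qed

lemma DERIV_along_line:
  fixes f :: "real^'n \<Rightarrow> real"
  assumes "f differentiable (at (x0 + t *\<^sub>R d))"
  shows "((\<lambda>t. f (x0 + t *\<^sub>R d)) has_real_derivative
           d \<bullet> (\<chi> i. partial i f (x0 + t *\<^sub>R d))) (at t)"
proof -
  have "((\<lambda>t. x0 + t *\<^sub>R d) has_derivative (\<lambda>s. s *\<^sub>R d)) (at t)"
    by (auto intro!: derivative_eq_intros)
  from has_derivative_compose[OF this GDERIV_partials[OF assms, unfolded gderiv_def]]
  show ?thesis by (simp add: has_field_derivative_def mult.commute[of _ "d \<bullet> _"])
qed

lemma DERIV2_along_line:
  fixes f :: "real^'n \<Rightarrow> real"
  assumes "\<And>i. partial i f differentiable (at (x0 + t *\<^sub>R d))"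
  shows "((\<lambda>t. d \<bullet> (\<chi> i. partial i f (x0 + t *\<^sub>R d))) has_real_derivative
           d \<bullet> (hessian f (x0 + t *\<^sub>R d) *v d)) (at t)"
proof -
  have "((\<lambda>t. \<Sum>j\<in>UNIV. d $ j * partial j f (x0 + t *\<^sub>R d)) has_real_derivative
      (\<Sum>j\<in>UNIV. d $ j * (d \<bullet> (\<chi> i. partial i (partial j f) (x0 + t *\<^sub>R d))))) (at t)"
    by (intro DERIV_sum DERIV_cmult DERIV_along_line assms)
  moreover have "(\<Sum>j\<in>UNIV. d $ j * (d \<bullet> (\<chi> i. partial i (partial j f) y)))
      = d \<bullet> (hessian f y *v d)" for y
  proof -
    have "(\<Sum>j\<in>UNIV. d $ j * (d \<bullet> (\<chi> i. partial i (partial j f) y)))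
        = (\<Sum>j\<in>UNIV. \<Sum>i\<in>UNIV. d $ j * (d $ i * partial i (partial j f) y))"
      by (simp add: inner_vec_def sum_distrib_left)
    also have "\<dots> = (\<Sum>i\<in>UNIV. \<Sum>j\<in>UNIV. d $ j * (d $ i * partial i (partial j f) y))"
      by (rule sum.swap)
    also have "\<dots> = d \<bullet> (hessian f y *v d)"
      by (simp add: inner_vec_def matrix_vector_mult_def hessian_def sum_distrib_left mult_ac)
    finally show ?thesis .
  qed
  ultimately show ?thesis by (simp add: inner_vec_def)
qed

section \<open>Central differences\<close>

text \<open>The two functions \<open>h - G\<close> and \<open>- h - G\<close> decrease from the value \<open>0\<close>. Two applications of
  this comparison replace the integral form of Taylor's theorem below.\<close>

lemma abs_le_of_deriv_le:
  fixes h G :: "real \<Rightarrow> real"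
  assumes "0 \<le> t"
    and h: "\<And>s. 0 \<le> s \<Longrightarrow> s \<le> t \<Longrightarrow> (h has_real_derivative h' s) (at s)"
    and G: "\<And>s. (G has_real_derivative G' s) (at s)"
    and le: "\<And>s. 0 \<le> s \<Longrightarrow> s \<le> t \<Longrightarrow> \<bar>h' s\<bar> \<le> G' s"
    and 0: "h 0 = 0" "G 0 = 0"
  shows "\<bar>h t\<bar> \<le> G t"
proof -
  have "h 0 - G 0 \<ge> h t - G t"
    by (rule DERIV_nonpos_imp_nonincreasing[OF \<open>0 \<le> t\<close>, where f="\<lambda>s. h s - G s"])
      (use h G le in \<open>force intro!: DERIV_diff exI\<close>)
  moreover have "h 0 + G 0 \<le> h t + G t"
    by (rule DERIV_nonneg_imp_nondecreasing[OF \<open>0 \<le> t\<close>, where f="\<lambda>s. h s + G s"])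
      (use h G le in \<open>force intro!: DERIV_add exI\<close>)
  ultimately show ?thesis using 0 by linarith
qed

text \<open>Along the line through \<open>x0\<close> with direction \<open>d\<close>, put
  \<open>h t = f (x0 + t d) - f (x0 - t d) - 2 t (d \<bullet> \<nabla>f x0)\<close>. Both \<open>h\<close> and \<open>h'\<close> vanish at \<open>0\<close>, and
  \<open>h'' t\<close> is a difference of two Hessian forms at points \<open>2 t \<parallel>d\<parallel>\<close> apart, so
  \<open>\<bar>h'' t\<bar> \<le> 2 L \<parallel>d\<parallel>\<^sup>3 t\<close>. Integrating twice gives \<open>\<bar>h 1\<bar> \<le> L \<parallel>d\<parallel>\<^sup>3 / 3\<close>, which is twice the
  claimed bound.\<close>

lemma central_difference_error:
  fixes f :: "real^'n \<Rightarrow> real"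
  assumes C2: "Ck_on 2 f (ball x0 r)"
    and Lip: "\<And>y z. y \<in> ball x0 r \<Longrightarrow> z \<in> ball x0 r \<Longrightarrow>
      opnorm (hessian f y - hessian f z) \<le> L * norm (y - z)"
    and d: "norm d < r"
  shows "\<bar>(f (x0 + d) - f (x0 - d)) / 2 - d \<bullet> (\<chi> i. partial i f x0)\<bar> \<le> L / 6 * norm d ^ 3"
proof -
  let ?g = "\<lambda>y. \<chi> i. partial i f y"
  have f1: "f differentiable (at y)" and f2: "partial i f differentiable (at y)"
    if "y \<in> ball x0 r" for y i
    using C2 that by (simp_all add: numeral_2_eq_2)
  have ball: "x0 + t *\<^sub>R d \<in> ball x0 r" "x0 + t *\<^sub>R (- d) \<in> ball x0 r"
    if "0 \<le> t" "t \<le> 1" for t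
  proof -
    have "t * norm d < r"
      using that d mult_left_le_one_le[of "norm d" t] by simp
    then show "x0 + t *\<^sub>R d \<in> ball x0 r" "x0 + t *\<^sub>R (- d) \<in> ball x0 r"
      using that by (simp_all add: dist_norm)
  qed
  \<comment> \<open>The reflected point is kept as \<open>x0 + t (- d)\<close> so that the rules for derivatives along a
    line apply to it with direction \<open>- d\<close>.\<close>
  define h where "h t = f (x0 + t *\<^sub>R d) - f (x0 + t *\<^sub>R (- d)) - t * (2 * (d \<bullet> ?g x0))" for t
  define h' where "h' t = d \<bullet> ?g (x0 + t *\<^sub>R d) - (- d) \<bullet> ?g (x0 + t *\<^sub>R (- d))
      - 2 * (d \<bullet> ?g x0)" for t
  define h'' where "h'' t = d \<bullet> (hessian f (x0 + t *\<^sub>R d) *v d)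
      - (- d) \<bullet> (hessian f (x0 + t *\<^sub>R (- d)) *v (- d))" for t
  have Dh: "(h has_real_derivative h' t) (at t)" if "0 \<le> t" "t \<le> 1" for t
    unfolding h_def h'_def
    by (rule derivative_eq_intros DERIV_along_line f1 ball that refl | simp)+
  have Dh': "(h' has_real_derivative h'' t) (at t)" if "0 \<le> t" "t \<le> 1" for t
    unfolding h'_def h''_def
    by (rule derivative_eq_intros DERIV2_along_line f2 ball that refl | simp)+
  have h0: "h 0 = 0" "h' 0 = 0" by (simp_all add: h_def h'_def)
  have h''_le: "\<bar>h'' t\<bar> \<le> 2 * L * norm d ^ 3 * t" if t: "0 \<le> t" "t \<le> 1" for t
  proof -
    let ?y = "x0 + t *\<^sub>R d" and ?z = "x0 + t *\<^sub>R (- d)"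
    let ?M = "hessian f ?y - hessian f ?z"
    have yz: "norm (?y - ?z) = 2 * t * norm d"
    proof -
      have "?y - ?z = (2 * t) *\<^sub>R d" by (simp add: scaleR_2 flip: scaleR_scaleR)
      then show ?thesis using t by simp
    qed
    have neg: "M *v (- d) = - (M *v d)" for M :: "real^'n^'n"
      using matrix_vector_mult_scaleR[of M "-1" d] by simp
    have "h'' t = d \<bullet> (?M *v d)"
      by (simp add: h''_def matrix_vector_mult_diff_rdistrib inner_diff_right neg)
    also have "\<bar>\<dots>\<bar> \<le> norm d * norm (?M *v d)" by (rule Cauchy_Schwarz_ineq2)
    also have "\<dots> \<le> norm d * (opnorm ?M * norm d)"
      by (intro mult_left_mono norm_matrix_vector_le_opnorm) simp
    also have "\<dots> \<le> norm d * ((L * norm (?y - ?z)) * norm d)"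
      by (intro mult_left_mono mult_right_mono Lip ball t) simp_all
    also have "\<dots> = 2 * L * norm d ^ 3 * t"
      unfolding yz by (simp add: power3_eq_cube)
    finally show ?thesis .
  qed
  have h'_le: "\<bar>h' t\<bar> \<le> L * norm d ^ 3 * t\<^sup>2" if t: "0 \<le> t" "t \<le> 1" for t
  proof (rule abs_le_of_deriv_le[where h' = h'' and G = "\<lambda>s. L * norm d ^ 3 * s\<^sup>2"
        and G' = "\<lambda>s. 2 * L * norm d ^ 3 * s"])
    show "((\<lambda>t. L * norm d ^ 3 * t\<^sup>2) has_real_derivative 2 * L * norm d ^ 3 * s) (at s)" for s
      by (auto intro!: derivative_eq_intros)
  qed (use t Dh' h''_le h0 in auto)
  have "\<bar>h 1\<bar> \<le> L * norm d ^ 3 * 1 ^ 3 / 3"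
  proof (rule abs_le_of_deriv_le[where h' = h' and G = "\<lambda>s. L * norm d ^ 3 * s ^ 3 / 3"
        and G' = "\<lambda>s. L * norm d ^ 3 * s\<^sup>2"])
    show "((\<lambda>t. L * norm d ^ 3 * t ^ 3 / 3) has_real_derivative L * norm d ^ 3 * s\<^sup>2) (at s)" for s
      by (auto intro!: derivative_eq_intros)
  qed (use Dh h'_le h0 in auto)
  moreover have "(f (x0 + d) - f (x0 - d)) / 2 - d \<bullet> ?g x0 = h 1 / 2"
    by (simp add: h_def diff_divide_distrib)
  ultimately show ?thesis by (simp only: abs_divide) simp
qed

section \<open>The error bound\<close>

text \<open>The derivative of \<open>f\<^sub>U\<close> at \<open>x0\<close> sends \<open>h\<close> to \<open>Proj U h \<bullet> \<nabla>f x0\<close>; moving the self-adjoint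
  projection to the other factor turns this into a gradient.\<close>

lemma gradient_powr_restrict_proj:
  fixes f :: "real^'n \<Rightarrow> real"
  assumes U: "subspace U" and f: "f differentiable (at x0)" and a: "a > 0"
  shows "gradient (\<lambda>y. a powr restrict_proj U x0 f y) x0
    = (a powr f x0 * ln a) *\<^sub>R Proj U (\<chi> i. partial i f x0)"
proof (rule gradient_eqI)
  have P: "bounded_linear (Proj U)"
    using linear_Proj[OF U] linear_conv_bounded_linear by blast
  have P0: "Proj U 0 = 0" by (rule linear_0[OF linear_Proj[OF U]])
  have "((\<lambda>y. x0 + Proj U (y - x0)) has_derivative Proj U) (at x0)"
    by (auto intro!: derivative_eq_intros bounded_linear.has_derivative[OF P])
  moreover have "(f has_derivative (\<lambda>h. h \<bullet> (\<chi> i. partial i f x0)))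
      (at (x0 + Proj U (x0 - x0)))"
    using GDERIV_partials[OF f] by (simp add: gderiv_def P0)
  ultimately have "((\<lambda>y. f (x0 + Proj U (y - x0))) has_derivative
      (\<lambda>h. Proj U h \<bullet> (\<chi> i. partial i f x0))) (at x0)"
    by (rule has_derivative_compose)
  then have "GDERIV (restrict_proj U x0 f) x0 :> Proj U (\<chi> i. partial i f x0)"
    by (simp add: gderiv_def restrict_proj_def[abs_def] Proj_self_adjoint[OF U])
  moreover have "DERIV (\<lambda>s. a powr s) (restrict_proj U x0 f x0) :> a powr f x0 * ln a"
    using a by (auto intro!: derivative_eq_intros simp: restrict_proj_def P0)
  ultimately show "GDERIV (\<lambda>y. a powr restrict_proj U x0 f y) x0 :>
      (a powr f x0 * ln a) *\<^sub>R Proj U (\<chi> i. partial i f x0)"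
    by (rule GDERIV_DERIV_compose)
qed

theorem proposition5p11:
  fixes f :: "real^'n \<Rightarrow> real"
    and x0 :: "real^'n" and x :: "'m::finite \<Rightarrow> real^'n"
    and \<Delta>bar L a :: real
  defines "\<Delta> \<equiv> radius x0 x"
    and "S \<equiv> sample_matrix x0 x"
  defines "U \<equiv> span (columns S)"
    and "Shat \<equiv> (1 / \<Delta>) *\<^sub>R S"
  assumes "Ck_on 3 f (ball x0 \<Delta>bar)"
    and "\<forall>y\<in>ball x0 \<Delta>bar. \<forall>z\<in>ball x0 \<Delta>bar.
           opnorm (hessian f y - hessian f z) \<le> L * norm (y - z)"
    and "inj x" and "\<forall>i. x i \<noteq> x0"
    and "\<Delta> < \<Delta>bar"
    and "rank S = min CARD('m) CARD('n)"
    and "a > 0"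
  shows "norm (centred_calculus_gradient_exp a f x0 x
               - gradient (\<lambda>y. a powr restrict_proj U x0 f y) x0)
         \<le> \<bar>a powr f x0 * ln a\<bar> * (L * sqrt (real CARD('m)) / 6)
             * opnorm (pinv (transpose Shat)) * \<Delta>\<^sup>2"
proof -
  define A where "A = transpose S"
  define g where "g = (\<chi> i. partial i f x0)"
  define e where "e = delta_c f x0 x - A *v g"
  have d_le: "norm (x i - x0) \<le> \<Delta>" for i
    unfolding \<Delta>_def radius_def by (intro Max_ge) auto
  have "\<Delta> > 0"
    using d_le[of undefined] assms(8) by (smt (verit) zero_less_norm_iff right_minus_eq)
  have C2: "Ck_on 2 f (ball x0 \<Delta>bar)"
    using assms(5) Ck_on_Suc_imp_Ck_on[of 2 f] by (simp add: numeral_3_eq_3 numeral_2_eq_2)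
  \<comment> \<open>The ball contains two distinct points, so the Lipschitz hypothesis forces \<open>L\<close> to be
    nonnegative; this is what permits replacing each step length by \<open>\<Delta>\<close>.\<close>
  have "L \<ge> 0"
  proof -
    let ?y = "x undefined"
    have "?y \<in> ball x0 \<Delta>bar" "x0 \<in> ball x0 \<Delta>bar"
      using d_le[of undefined] assms(9) \<open>\<Delta> > 0\<close> by (auto simp: dist_norm norm_minus_commute)
    then have "0 \<le> L * norm (?y - x0)"
      using assms(6) opnorm_nonneg order_trans by blast
    then show ?thesis using assms(8) by (simp add: zero_le_mult_iff)
  qed
  have "\<bar>e $ i\<bar> \<le> L / 6 * \<Delta> ^ 3" for i
  proof -
    let ?d = "x i - x0"
    have "(A *v g) $ i = ?d \<bullet> g"
      by (simp add: A_def S_def sample_matrix_def matrix_vector_mult_def transpose_def inner_vec_def)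
    then have "\<bar>e $ i\<bar> = \<bar>(f (x0 + ?d) - f (x0 - ?d)) / 2 - ?d \<bullet> g\<bar>"
      by (simp add: e_def delta_c_def)
    also have "\<dots> \<le> L / 6 * norm ?d ^ 3"
      unfolding g_def using C2 assms(6) d_le[of i] assms(9)
      by (intro central_difference_error) auto
    also have "\<dots> \<le> L / 6 * \<Delta> ^ 3"
      using \<open>L \<ge> 0\<close> d_le by (intro mult_left_mono power_mono) auto
    finally show ?thesis .
  qed
  then have e_le: "norm e \<le> sqrt (real CARD('m)) * (L / 6 * \<Delta> ^ 3)"
    by (rule norm_le_sqrt_card)
  have f: "f differentiable (at x0)"
    using C2 \<open>\<Delta> > 0\<close> assms(9) by (simp add: numeral_2_eq_2)
  have "Proj U g = pinv A *v (A *v g)"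
    using pinv_mult_is_Proj_rowspace[of A g] by (simp only: A_def U_def transpose_transpose)
  then have eq: "centred_calculus_gradient_exp a f x0 x
        - gradient (\<lambda>y. a powr restrict_proj U x0 f y) x0
      = (a powr f x0 * ln a) *\<^sub>R (pinv A *v e)"
    using gradient_powr_restrict_proj[OF _ f \<open>a > 0\<close>, of U]
    by (simp add: U_def centred_calculus_gradient_exp_def centred_simplex_gradient_def A_def S_def
        e_def g_def matrix_vector_mult_diff_distrib scaleR_diff_right)
  have scale: "opnorm (pinv (transpose Shat)) = \<Delta> * opnorm (pinv A)"
  proof -
    have "transpose Shat = (1 / \<Delta>) *\<^sub>R A"
      by (simp add: Shat_def A_def transpose_scalar)
    then show ?thesis using \<open>\<Delta> > 0\<close> by (simp add: pinv_scaleR opnorm_scaleR)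
  qed
  have "norm (pinv A *v e) \<le> opnorm (pinv A) * (sqrt (real CARD('m)) * (L / 6 * \<Delta> ^ 3))"
    using norm_matrix_vector_le_opnorm[of "pinv A" e] mult_left_mono[OF e_le opnorm_nonneg, of "pinv A"]
    by linarith
  also have "\<dots> = (L * sqrt (real CARD('m)) / 6) * opnorm (pinv (transpose Shat)) * \<Delta>\<^sup>2"
    unfolding scale by (simp add: power3_eq_cube power2_eq_square)
  finally have "\<bar>a powr f x0 * ln a\<bar> * norm (pinv A *v e)
      \<le> \<bar>a powr f x0 * ln a\<bar>
        * ((L * sqrt (real CARD('m)) / 6) * opnorm (pinv (transpose Shat)) * \<Delta>\<^sup>2)"
    by (intro mult_left_mono) auto
  then show ?thesis unfolding eq by (simp add: mult.assoc)
qed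

end
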